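(* Let $N$ be an arbitrary finite positive integer. For $u,v\in\mathbb{C}$ define $$f(u,v)=\sum_{m_1=1}^{N}\sum_{m_2=1}^{N}\frac{1}{m_1^{u}}\frac{1}{(m_1+m_2)^{v}},\qquad g(u,v)=\sum_{m=1}^{N}\sum_{n=N+1}^{N+m}\frac{1}{m^{u}n^{v}}.$$ Then for all $u,v\in\mathbb{C}$, $$f(u,v)+f(v,u)+\sum_{m=1}^{N}\frac{1}{m^{u+v}}=\left(\sum_{m=1}^{N}\frac{1}{m^{u}}\right)\left(\sum_{n=1}^{N}\frac{1}{n^{v}}\right)+g(u,v)+g(v,u).$$
   Context: For a positive integer $k$ and $w\in\mathbb{C}$, $k^{w}=e^{w\ln k}$ with the real logarithm. *)

theory Defs
  imports "HOL-Analysis.Complex_Transcendental"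
begin

definition f :: "nat \<Rightarrow> complex \<Rightarrow> complex \<Rightarrow> complex" where
  "f N u v = (\<Sum>m1 = 1..N. \<Sum>m2 = 1..N.
     1 / of_nat m1 powr u * (1 / of_nat (m1 + m2) powr v))"

definition g :: "nat \<Rightarrow> complex \<Rightarrow> complex \<Rightarrow> complex" where
  "g N u v = (\<Sum>m = 1..N. \<Sum>n = N + 1..N + m.
     1 / (of_nat m powr u * of_nat n powr v))"

text \<open>The complex \<open>powr\<close> uses the principal branch of the logarithm; at a positive
  integer base this is the real logarithm.\<close>

lemma of_nat_powr_eq_exp_real_ln:
  fixes k :: nat and w :: complex
  assumes "0 < k"
  shows "of_nat k powr w = exp (w * of_real (ln (real k)))"
  using assms by (simp add: powr_def Ln_of_nat)

end

theory Submission
  imports Defs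
begin

text \<open>Put \<open>n = m\<^sub>1 + m\<^sub>2\<close> in \<open>f\<close>, so that \<open>n\<close> runs over \<open>m + 1, \<dots>, m + N\<close>. The terms with
  \<open>n > N\<close> form \<open>g\<close>; those with \<open>n \<le> N\<close> form the part \<open>m < n\<close> of the square \<open>{1..N}\<^sup>2\<close>. The two
  triangles coming from \<open>f(u,v)\<close> and \<open>f(v,u)\<close>, together with the diagonal, make up the square.\<close>

text \<open>By trichotomy each row \<open>m\<close> splits into \<open>n > m\<close>,
  \<open>n < m\<close> and \<open>n = m\<close>. The lower triangle is then reflected onto the upper
  one, which swaps the arguments of \<open>h\<close>.\<close>

lemma sum_square_split_diagonal:
  fixes h :: "'a::linorder \<Rightarrow> 'a \<Rightarrow> 'b::comm_monoid_add"
  assumes "finite A"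
  shows "(\<Sum>m\<in>A. \<Sum>n\<in>A. h m n)
       = (\<Sum>m\<in>A. \<Sum>n | n \<in> A \<and> m < n. h m n) + (\<Sum>m\<in>A. \<Sum>n | n \<in> A \<and> m < n. h n m)
         + (\<Sum>m\<in>A. h m m)"
proof -
  have "(\<Sum>n\<in>A. h m n)
      = (\<Sum>n | n \<in> A \<and> m < n. h m n) + (\<Sum>n | n \<in> A \<and> n < m. h m n) + h m m" if "m \<in> A" for m
  proof -
    have "A = ({n \<in> A. m < n} \<union> {n \<in> A. n < m}) \<union> {m}"
      using that by auto
    then have "(\<Sum>n\<in>A. h m n) = (\<Sum>n \<in> ({n \<in> A. m < n} \<union> {n \<in> A. n < m}) \<union> {m}. h m n)"
      by simp
    also have "\<dots> = (\<Sum>n \<in> {n \<in> A. m < n} \<union> {n \<in> A. n < m}. h m n) + h m m"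
      using assms by (subst sum.union_disjoint) auto
    also have "(\<Sum>n \<in> {n \<in> A. m < n} \<union> {n \<in> A. n < m}. h m n)
        = (\<Sum>n | n \<in> A \<and> m < n. h m n) + (\<Sum>n | n \<in> A \<and> n < m. h m n)"
      using assms by (intro sum.union_disjoint) auto
    finally show ?thesis .
  qed
  \<comment> \<open>Exchanging the order of summation, with the bound names swapped, performs the
    reflection.\<close>
  moreover have "(\<Sum>m\<in>A. \<Sum>n | n \<in> A \<and> n < m. h m n) = (\<Sum>m\<in>A. \<Sum>n | n \<in> A \<and> m < n. h n m)"
    by (rule sum.swap_restrict[OF assms assms])
  ultimately show ?thesis
    by (simp add: sum.distrib)
qed

lemma f_eq_triangle_plus_g:
  "f N u v = (\<Sum>m = 1..N. \<Sum>n | n \<in> {1..N} \<and> m < n. 1 / (of_nat m powr u * of_nat n powr v)) + g N u v"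
proof -
  have "(\<Sum>k = 1..N. 1 / of_nat m powr u * (1 / of_nat (m + k) powr v))
      = (\<Sum>n | n \<in> {1..N} \<and> m < n. 1 / (of_nat m powr u * of_nat n powr v))
        + (\<Sum>n = N + 1..N + m. 1 / (of_nat m powr u * of_nat n powr v))"
    if "m \<in> {1..N}" for m
  proof -
    have "(\<Sum>k = 1..N. 1 / of_nat m powr u * (1 / of_nat (m + k) powr v))
        = (\<Sum>n = 1 + m..N + m. 1 / (of_nat m powr u * of_nat n powr v))"
      by (simp only: sum.shift_bounds_cl_nat_ivl) (simp add: add.commute)
    \<comment> \<open>Cut at \<open>N\<close>: since \<open>m \<le> N\<close>, the upper block lies
      entirely above \<open>m\<close>.\<close>
    also have "{1 + m..N + m} = {n \<in> {1..N}. m < n} \<union> {N + 1..N + m}"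
      using that by auto
    finally show ?thesis
      by (simp only:) (rule sum.union_disjoint, auto)
  qed
  then show ?thesis
    by (simp add: f_def g_def sum.distrib)
qed

theorem lemma3p2:
  fixes N :: nat and u v :: complex
  assumes "0 < N"
  shows "f N u v + f N v u + (\<Sum>m = 1..N. 1 / of_nat m powr (u + v))
       = (\<Sum>m = 1..N. 1 / of_nat m powr u) * (\<Sum>n = 1..N. 1 / of_nat n powr v)
         + g N u v + g N v u"
proof -
  have "(\<Sum>m = 1..N. 1 / of_nat m powr u) * (\<Sum>n = 1..N. 1 / of_nat n powr v)
      = (\<Sum>m = 1..N. \<Sum>n = 1..N. 1 / (of_nat m powr u * of_nat n powr v))"
    by (simp add: sum_product)
  also have "\<dots> = (\<Sum>m = 1..N. \<Sum>n | n \<in> {1..N} \<and> m < n. 1 / (of_nat m powr u * of_nat n powr v))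
      + (\<Sum>m = 1..N. \<Sum>n | n \<in> {1..N} \<and> m < n. 1 / (of_nat m powr v * of_nat n powr u))
      + (\<Sum>m = 1..N. 1 / of_nat m powr (u + v))"
    \<comment> \<open>Commuting the factors turns the reflected triangle into that of
      \<open>f N v u\<close>; on the diagonal the exponents add.\<close>
    by (subst sum_square_split_diagonal) (simp_all add: powr_add mult.commute)
  finally show ?thesis
    by (simp only: f_eq_triangle_plus_g) (simp add: algebra_simps)
qed

end
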